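(* Let $n>1$ and let $A$ be a nonzero $n\times n$ complex matrix. If $A$ has a spanning disk certificate (or in particular if $A$ is strongly certified), then $A$ satisfies the multiplicity property.
   Context: Numerical radius: $r(A)=\max\{|u^*Au| : u\in\mathbb{C}^n,\ \|u\|_2=1\}$. Let $\mathbb{T}=\{w\in\mathbb{C}:|w|=1\}$. A polynomial $n$-vector of degree less than $n$ is a vector $p(w)=\sum_{j=1}^n p^j w^{j-1}$ with $p^j\in\mathbb{C}^n$. A disk certificate for a nonzero $n\times n$ matrix $A$ is a nonzero polynomial $n$-vector $p$ of degree less than $n$ satisfying $(w^*A+wA^* )p(w)=2r(A)p(w)$ for all $w\in\mathbb{T}$ (where $w^*$ is the complex conjugate of $w$). It is spanning if $p(\mathbb{T})$ spans $\mathbb{C}^n$. The matrix $A$ is separated if for every $w\in\mathbb{T}$ the largest eigenvalue of the Hermitian matrix $w^*A+wA^*$ is simple; $A$ is strongly certified if it is separated and has a spanning disk certificate. For an $n\times n$ Hermitian matrix $Z$, put $\Phi_A(Z)=\begin{bmatrix} Z & A\\ A^* & -Z\end{bmatrix}$, and let $\lambda_{\max}$ denote the largest eigenvalue. An SDP-representor for $A$ is any minimizer, over all $n\times n$ Hermitian matrices $Z$, of $Z\mapsto\lambda_{\max}(\Phi_A(Z))$. The matrix $A$ has the multiplicity property if there exists an SDP-representor $Z$ for $A$ such that the largest eigenvalue of $\Phi_A(Z)$ has multiplicity strictly larger than $n$. *)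

theory Defs
  imports "HOL-Analysis.Analysis"
begin

text \<open>
  Matrices are elements of \<^typ>\<open>complex^'n^'n\<close>, with \<open>n = CARD('n)\<close>. The norm of
  \<^typ>\<open>complex^'n\<close> is the Euclidean norm; \<open>vec.span\<close> and \<open>vec.dim\<close> are the span and the
  dimension over the complex field (\<open>span\<close> and \<open>dim\<close> would be over the reals).
\<close>

definition conj_transpose :: "complex^'n^'m \<Rightarrow> complex^'m^'n" where
  "conj_transpose A = transpose (map_matrix cnj A)"

definition hermitian_matrix :: "complex^'n^'n \<Rightarrow> bool" where
  "hermitian_matrix H \<longleftrightarrow> conj_transpose H = H"

definition quad_form :: "complex^'n^'n \<Rightarrow> complex^'n \<Rightarrow> complex" where
  "quad_form A u = (\<Sum>i\<in>UNIV. cnj (u $ i) * (A *v u) $ i)"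

text \<open>The supremum is a maximum, by compactness of the unit sphere.\<close>

definition numerical_radius :: "complex^'n^'n \<Rightarrow> real" where
  "numerical_radius A = (SUP u\<in>{u. norm u = 1}. cmod (quad_form A u))"

definition is_eigenvalue :: "complex^'n^'n \<Rightarrow> complex \<Rightarrow> bool" where
  "is_eigenvalue H c \<longleftrightarrow> (\<exists>v. v \<noteq> 0 \<and> H *v v = c *s v)"

text \<open>
  The next two notions are used for Hermitian matrices only: there all eigenvalues are real,
  and the dimension of an eigenspace is also the algebraic multiplicity of the eigenvalue.
\<close>

definition largest_eigenvalue :: "complex^'n^'n \<Rightarrow> real" where
  "largest_eigenvalue H = Max {x. is_eigenvalue H (complex_of_real x)}"

definition eigenvalue_mult :: "complex^'n^'n \<Rightarrow> complex \<Rightarrow> nat" where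
  "eigenvalue_mult H c = vec.dim {v. H *v v = c *s v}"

text \<open>The Hermitian matrix \<open>w\<^sup>* A + w A\<^sup>*\<close>.\<close>

definition hermitian_pencil :: "complex^'n^'n \<Rightarrow> complex \<Rightarrow> complex^'n^'n" where
  "hermitian_pencil A w =
     map_matrix ((*) (cnj w)) A + map_matrix ((*) w) (conj_transpose A)"

text \<open>
  A polynomial \<open>n\<close>-vector of degree less than \<open>n\<close> is given by its coefficient vectors
  \<open>p 1, \<dots>, p n\<close>; the values of \<open>p\<close> at all other indices are irrelevant.
\<close>

definition polyvec :: "(nat \<Rightarrow> complex^'n) \<Rightarrow> complex \<Rightarrow> complex^'n" where
  "polyvec p w = (\<Sum>j=1..CARD('n). w ^ (j - 1) *s p j)"

definition disk_certificate :: "complex^'n^'n \<Rightarrow> (nat \<Rightarrow> complex^'n) \<Rightarrow> bool" where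
  "disk_certificate A p \<longleftrightarrow>
     (\<exists>j\<in>{1..CARD('n)}. p j \<noteq> 0) \<and>
     (\<forall>w. cmod w = 1 \<longrightarrow>
        hermitian_pencil A w *v polyvec p w
          = complex_of_real (2 * numerical_radius A) *s polyvec p w)"

definition spanning_polyvec :: "(nat \<Rightarrow> complex^'n) \<Rightarrow> bool" where
  "spanning_polyvec p \<longleftrightarrow> vec.span (polyvec p ` {w. cmod w = 1}) = UNIV"

definition has_spanning_disk_certificate :: "complex^'n^'n \<Rightarrow> bool" where
  "has_spanning_disk_certificate A \<longleftrightarrow> (\<exists>p. disk_certificate A p \<and> spanning_polyvec p)"

definition separated :: "complex^'n^'n \<Rightarrow> bool" where
  "separated A \<longleftrightarrow>
     (\<forall>w. cmod w = 1 \<longrightarrow>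
        eigenvalue_mult (hermitian_pencil A w)
          (complex_of_real (largest_eigenvalue (hermitian_pencil A w))) = 1)"

definition strongly_certified :: "complex^'n^'n \<Rightarrow> bool" where
  "strongly_certified A \<longleftrightarrow> separated A \<and> has_spanning_disk_certificate A"

text \<open>
  The block matrix \<open>[Z, A; A\<^sup>*, -Z]\<close>; \<^const>\<open>Inl\<close> indexes the first block row and column,
  \<^const>\<open>Inr\<close> the second.
\<close>

definition Phi :: "complex^'n^'n \<Rightarrow> complex^'n^'n \<Rightarrow> complex^('n + 'n)^('n + 'n)" where
  "Phi A Z = (\<chi> i j. case (i, j) of
       (Inl a, Inl b) \<Rightarrow> Z $ a $ b
     | (Inl a, Inr b) \<Rightarrow> A $ a $ b
     | (Inr a, Inl b) \<Rightarrow> conj_transpose A $ a $ b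
     | (Inr a, Inr b) \<Rightarrow> - Z $ a $ b)"

definition sdp_representor :: "complex^'n^'n \<Rightarrow> complex^'n^'n \<Rightarrow> bool" where
  "sdp_representor A Z \<longleftrightarrow>
     hermitian_matrix Z \<and>
     (\<forall>Y. hermitian_matrix Y \<longrightarrow>
        largest_eigenvalue (Phi A Z) \<le> largest_eigenvalue (Phi A Y))"

definition multiplicity_property :: "complex^'n^'n \<Rightarrow> bool" where
  "multiplicity_property A \<longleftrightarrow>
     (\<exists>Z. sdp_representor A Z \<and>
        eigenvalue_mult (Phi A Z) (complex_of_real (largest_eigenvalue (Phi A Z))) > CARD('n))"

end

(*
Let q_1, ..., q_n be the coefficients of the certificate, q_j = 0 for all other j, and r = r(A).
Comparing coefficients gives A q_{j+1} + A^* q_{j-1} = 2r q_j for all j, and spanning means that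
q_1, ..., q_n is a basis. The linear map Z with Z q_j = r q_j - A q_{j+1} is Hermitian by the
recurrence, and each of the n+1 independent vectors k_j = (q_j, q_{j+1}), 0 <= j <= n, satisfies
Phi_A(Z) k_j = r k_j. Every block vector is the sum of an element of span {k_j} and a diagonal
vector (u, u), on which the form of r - Phi_A(Z) is 2 (r |u|^2 - Re u^* A u) >= 0. Hence
Phi_A(Z) <= r. Conversely lambda_max(Phi_A(Y)) >= r for every Hermitian Y, by testing on vectors
(u, w u) with |w| = 1.
*)

theory Submission
  imports Defs
begin

section \<open>Self-adjoint operators\<close>

text \<open>At a maximizer \<open>v\<close> of the Rayleigh quotient with value \<open>m\<close>,
  the form of \<open>m - f\<close> is nonnegative and vanishes at \<open>v\<close>; this forces
  \<open>v\<close> into the kernel of \<open>m - f\<close>.\<close>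

lemma selfadjoint_max_eigenvalue:
  fixes f :: "'a::euclidean_space \<Rightarrow> 'a"
  assumes lin: "linear f" and sa: "\<And>x y. f x \<bullet> y = x \<bullet> f y"
  obtains m v where "v \<noteq> 0" "f v = m *\<^sub>R v" "\<And>x. f x \<bullet> x \<le> m * (x \<bullet> x)"
proof -
  have "continuous_on (sphere 0 1) (\<lambda>x. f x \<bullet> x)"
    using linear_continuous_on_compose[OF continuous_on_id lin] by (intro continuous_intros) auto
  moreover have "sphere (0::'a) 1 \<noteq> {}"
    by (metis vector_choose_size mem_sphere_0 empty_iff zero_le_one)
  ultimately obtain v where v: "norm v = 1" and mx: "\<And>x. norm x = 1 \<Longrightarrow> f x \<bullet> x \<le> f v \<bullet> v"
    using continuous_attains_sup[of "sphere 0 1" "\<lambda>x. f x \<bullet> x"] by auto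
  define m where "m = f v \<bullet> v"
  have bound: "f x \<bullet> x \<le> m * (x \<bullet> x)" for x
  proof (cases "x = 0")
    case False
    have "f (x /\<^sub>R norm x) \<bullet> (x /\<^sub>R norm x) \<le> m"
      unfolding m_def by (rule mx) (use False in simp)
    moreover have "f (x /\<^sub>R norm x) \<bullet> (x /\<^sub>R norm x) = (f x \<bullet> x) / (x \<bullet> x)"
      by (simp add: linear_scale[OF lin] dot_square_norm power2_eq_square divide_inverse)
    ultimately have "(f x \<bullet> x) / (x \<bullet> x) \<le> m" by simp
    then show ?thesis
      using False by (simp add: pos_divide_le_eq)
  qed (simp add: linear_0[OF lin])
  define g where "g x = m *\<^sub>R x - f x" for x
  have g_sa: "g x \<bullet> y = x \<bullet> g y" for x y
    by (simp add: g_def inner_diff sa)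
  have g_add: "g (x + t *\<^sub>R y) = g x + t *\<^sub>R g y" for x y t
    by (simp add: g_def linear_add[OF lin] linear_scale[OF lin] algebra_simps)
  have g_nonneg: "0 \<le> g x \<bullet> x" for x
    using bound[of x] by (simp add: g_def inner_diff)
  have gv: "g v \<bullet> v = 0"
    using v by (simp add: g_def m_def inner_diff dot_square_norm)
  define a where "a = g v \<bullet> g v"
  define c where "c = g (g v) \<bullet> g v"
  have c: "0 \<le> c"
    unfolding c_def by (rule g_nonneg)
  \<comment> \<open>Perturbing \<open>v\<close> in the direction \<open>g v\<close> has first-order
    term \<open>2 t |g v|^2\<close>; nonnegativity for all \<open>t\<close> forces it to
    vanish.\<close>
  have quad: "0 \<le> 2 * t * a + t\<^sup>2 * c" for t
  proof -
    have "g (v + t *\<^sub>R g v) \<bullet> (v + t *\<^sub>R g v) = 2 * t * a + t\<^sup>2 * c"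
      using gv g_sa[of "g v" v]
      by (simp add: g_add inner_add a_def c_def power2_eq_square algebra_simps)
    then show ?thesis using g_nonneg by metis
  qed
  \<comment> \<open>Scaled so that at \<open>t = - a * s\<close> the linear term dominates; the
    \<open>+ 1\<close> covers \<open>c = 0\<close>.\<close>
  define s where "s = 1 / (c + 1)"
  have s: "0 < s" "s * c < 2"
    using c by (simp_all add: s_def field_simps)
  have "0 \<le> (s * a\<^sup>2) * (s * c - 2)"
    using quad[of "- a * s"] by (simp add: algebra_simps power2_eq_square)
  then have "s * a\<^sup>2 \<le> 0"
    using s by (simp add: zero_le_mult_iff)
  then have "a = 0"
    using s by (simp add: mult_le_0_iff)
  then have "f v = m *\<^sub>R v"
    by (simp add: a_def g_def)
  moreover have "v \<noteq> 0" using v by auto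
  ultimately show thesis using bound that by blast
qed

text \<open>Eigenvectors of distinct eigenvalues are orthogonal, hence independent. Finiteness gives
  \<open>Max\<close> in \<open>largest_eigenvalue\<close> its meaning.\<close>

lemma selfadjoint_finite_eigenvalues:
  fixes f :: "'a::euclidean_space \<Rightarrow> 'a"
  assumes sa: "\<And>x y. f x \<bullet> y = x \<bullet> f y"
  shows "finite {c. \<exists>v. v \<noteq> 0 \<and> f v = c *\<^sub>R v}" (is "finite ?E")
proof -
  obtain V where V: "\<And>c. c \<in> ?E \<Longrightarrow> V c \<noteq> 0 \<and> f (V c) = c *\<^sub>R V c"
    by (rule that[of "\<lambda>c. SOME v. v \<noteq> 0 \<and> f v = c *\<^sub>R v"], rule someI_ex) simp
  have orth: "V c \<bullet> V d = 0" if "c \<in> ?E" "d \<in> ?E" "c \<noteq> d" for c d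
  proof -
    have "c * (V c \<bullet> V d) = d * (V c \<bullet> V d)"
      using sa[of "V c" "V d"] V[OF that(1)] V[OF that(2)] by simp
    then show ?thesis using that(3) by simp
  qed
  have inj: "inj_on V ?E"
  proof (rule inj_onI, rule ccontr)
    fix c d assume "c \<in> ?E" "d \<in> ?E" "V c = V d" "c \<noteq> d"
    then show False using orth[of c d] V[of d] by (simp del: mem_Collect_eq)
  qed
  have "independent (V ` ?E)"
    by (rule pairwise_orthogonal_independent)
      (use orth V in \<open>fastforce simp: pairwise_def orthogonal_def simp del: mem_Collect_eq\<close>)+
  then show ?thesis
    using inj finite_imageD independent_imp_finite by blast
qed

section \<open>Complex matrices and the real inner product\<close>

text \<open>This lets results on real Euclidean spaces apply to complex vectors: the real inner
  product is the real part of the Hermitian one.\<close>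

lemma inner_vec_eq_Re: "u \<bullet> v = Re (\<Sum>i\<in>UNIV. cnj (u $ i) * v $ i)"
  for u v :: "complex^'n"
  by (simp add: inner_vec_def inner_complex_def)

lemma Re_quad_form: "Re (quad_form A u) = u \<bullet> (A *v u)"
  by (simp add: quad_form_def inner_vec_eq_Re)

lemma of_real_smult_eq_scaleR: "complex_of_real c *s v = c *\<^sub>R v"
  by (simp add: vec_eq_iff) (simp add: scaleR_conv_of_real)

lemma inner_smult_left: "(c *s u) \<bullet> v = u \<bullet> (cnj c *s v)"
  for u v :: "complex^'n"
  by (simp add: inner_vec_eq_Re ac_simps)

lemma inner_smult_unimodular: "cmod c = 1 \<Longrightarrow> (c *s u) \<bullet> (c *s v) = u \<bullet> v"
  for u v :: "complex^'n"
  using complex_norm_square[of c, symmetric] by (simp add: inner_smult_left vector_smult_assoc mult.commute)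

lemma inner_matrix_vector_left: "(A *v u) \<bullet> v = u \<bullet> (conj_transpose A *v v)"
  for A :: "complex^'n^'m"
proof -
  have "(\<Sum>i\<in>UNIV. cnj ((A *v u) $ i) * v $ i)
      = (\<Sum>i\<in>UNIV. \<Sum>j\<in>UNIV. cnj (A $ i $ j) * cnj (u $ j) * v $ i)"
    by (simp add: matrix_vector_mult_def sum_distrib_right)
  also have "\<dots> = (\<Sum>j\<in>UNIV. cnj (u $ j) * (conj_transpose A *v v) $ j)"
    by (subst sum.swap)
      (simp add: matrix_vector_mult_def conj_transpose_def transpose_def map_matrix_def
        sum_distrib_left ac_simps)
  finally show ?thesis by (simp add: inner_vec_eq_Re)
qed

lemma conj_transpose_conj_transpose [simp]: "conj_transpose (conj_transpose A) = A"
  by (simp add: conj_transpose_def transpose_def map_matrix_def vec_eq_iff)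

text \<open>Testing only real parts loses nothing, because the real inner product is already
  nondegenerate.\<close>

lemma hermitian_matrix_iff_selfadjoint:
  "hermitian_matrix H \<longleftrightarrow> (\<forall>u v. (H *v u) \<bullet> v = u \<bullet> (H *v v))"
proof
  assume "\<forall>u v. (H *v u) \<bullet> v = u \<bullet> (H *v v)"
  then have "u \<bullet> (conj_transpose H *v v) = u \<bullet> (H *v v)" for u v
    by (metis inner_matrix_vector_left)
  then show "hermitian_matrix H"
    unfolding hermitian_matrix_def matrix_eq by (metis vector_eq_ldot)
qed (simp add: hermitian_matrix_def inner_matrix_vector_left)

lemma linear_matrix_vector_complex: "linear ((*v) A)" for A :: "complex^'n^'m"
  by (rule linearI)
    (simp_all add: vec.add flip: of_real_smult_eq_scaleR, simp add: vec.scale)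

text \<open>The maximal Rayleigh quotient is itself an eigenvalue, so the finite set of eigenvalues
  is nonempty and its maximum dominates that quotient.\<close>

lemma largest_eigenvalue_hermitian:
  assumes "hermitian_matrix H"
  shows "\<exists>v. v \<noteq> 0 \<and> H *v v = largest_eigenvalue H *\<^sub>R v"
    and "(H *v x) \<bullet> x \<le> largest_eigenvalue H * (x \<bullet> x)"
proof -
  let ?E = "{c. \<exists>v. v \<noteq> 0 \<and> H *v v = c *\<^sub>R v}"
  have E: "largest_eigenvalue H = Max ?E"
    by (simp add: largest_eigenvalue_def is_eigenvalue_def of_real_smult_eq_scaleR)
  have sa: "(H *v x) \<bullet> y = x \<bullet> (H *v y)" for x y
    using assms hermitian_matrix_iff_selfadjoint by blast
  have fin: "finite ?E"
    using selfadjoint_finite_eigenvalues[OF sa] .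
  obtain m v where mv: "v \<noteq> 0" "H *v v = m *\<^sub>R v" "\<And>x. (H *v x) \<bullet> x \<le> m * (x \<bullet> x)"
    using selfadjoint_max_eigenvalue[OF linear_matrix_vector_complex sa] by metis
  have m: "m \<in> ?E" using mv by auto
  then have "Max ?E \<in> ?E"
    using Max_in[OF fin] by blast
  then show "\<exists>v. v \<noteq> 0 \<and> H *v v = largest_eigenvalue H *\<^sub>R v"
    unfolding E by blast
  have "m \<le> Max ?E"
    using Max_ge[OF fin m] .
  then have "m * (x \<bullet> x) \<le> Max ?E * (x \<bullet> x)"
    by (simp add: mult_right_mono)
  then show "(H *v x) \<bullet> x \<le> largest_eigenvalue H * (x \<bullet> x)"
    using mv(3)[of x] E by simp
qed

text \<open>Reduces to unit vectors, where the real part of the form is at most its modulus;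
  compactness of the sphere makes the supremum a genuine upper bound.\<close>

lemma inner_le_numerical_radius: "u \<bullet> (A *v u) \<le> numerical_radius A * (u \<bullet> u)"
proof (cases "u = 0")
  case False
  define e where "e = u /\<^sub>R norm u"
  have lin: "linear ((*v) A)" by (rule linear_matrix_vector_complex)
  have cont: "continuous_on (sphere 0 1) (\<lambda>u. cmod (quad_form A u))"
    unfolding quad_form_def
    using linear_continuous_on_compose[OF continuous_on_id lin] by (intro continuous_intros)
  have "bdd_above ((\<lambda>u. cmod (quad_form A u)) ` sphere 0 1)"
    by (rule bounded_imp_bdd_above[OF compact_imp_bounded[OF compact_continuous_image[OF cont compact_sphere]]])
  then have bdd: "bdd_above ((\<lambda>u. cmod (quad_form A u)) ` {u. norm u = 1})"
    by (simp add: sphere_def)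
  have "e \<bullet> (A *v e) \<le> cmod (quad_form A e)"
    by (metis Re_quad_form complex_Re_le_cmod)
  also have "\<dots> \<le> numerical_radius A"
    unfolding numerical_radius_def by (rule cSUP_upper[OF _ bdd]) (use False in \<open>simp add: e_def\<close>)
  finally have "e \<bullet> (A *v e) \<le> numerical_radius A" .
  moreover have "e \<bullet> (A *v e) = (u \<bullet> (A *v u)) / (u \<bullet> u)"
    by (simp add: e_def linear_scale[OF lin] dot_square_norm power2_eq_square divide_inverse)
  ultimately have "(u \<bullet> (A *v u)) / (u \<bullet> u) \<le> numerical_radius A" by simp
  then show ?thesis
    using False by (simp add: pos_divide_le_eq)
qed simp

section \<open>Block vectors\<close>

definition blk :: "complex^'n \<Rightarrow> complex^'n \<Rightarrow> complex^('n + 'n)" where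
  "blk x y = (\<chi> i. case i of Inl a \<Rightarrow> x $ a | Inr b \<Rightarrow> y $ b)"

lemma blk_nth [simp]: "blk x y $ Inl a = x $ a" "blk x y $ Inr a = y $ a"
  by (simp_all add: blk_def)

lemma blk_eq_iff: "v = blk x y \<longleftrightarrow> (\<forall>a. v $ Inl a = x $ a \<and> v $ Inr a = y $ a)"
  by (auto simp: vec_eq_iff) (metis blk_nth sum.exhaust)

lemma blk_eq_blk [simp]: "blk x y = blk x' y' \<longleftrightarrow> x = x' \<and> y = y'"
  by (simp only: blk_eq_iff blk_nth) (auto simp: vec_eq_iff)

lemma blk_cases: obtains x y where "v = blk x y"
proof
  show "v = blk (\<chi> a. v $ Inl a) (\<chi> a. v $ Inr a)"
    by (simp add: blk_eq_iff)
qed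

lemma blk_zero: "blk 0 0 = 0"
  by (metis blk_eq_iff zero_index)

lemma blk_add: "blk x y + blk x' y' = blk (x + x') (y + y')"
  by (simp add: blk_eq_iff)

lemma blk_smult: "c *s blk x y = blk (c *s x) (c *s y)"
  by (simp add: blk_eq_iff)

lemma blk_sum: "(\<Sum>i\<in>I. blk (f i) (g i)) = blk (\<Sum>i\<in>I. f i) (\<Sum>i\<in>I. g i)"
  by (simp add: blk_eq_iff)

lemma sum_UNIV_Plus:
  "(\<Sum>i\<in>(UNIV :: ('a::finite + 'b::finite) set). f i) = (\<Sum>a\<in>UNIV. f (Inl a)) + (\<Sum>b\<in>UNIV. f (Inr b))"
  by (simp add: UNIV_Plus_UNIV[symmetric] sum.Plus del: UNIV_Plus_UNIV)

lemma blk_inner: "blk x y \<bullet> blk x' y' = x \<bullet> x' + y \<bullet> y'"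
  by (simp add: inner_vec_def sum_UNIV_Plus)

section \<open>The block matrix and the lower bound for its largest eigenvalue\<close>

lemma Phi_blk: "Phi A Z *v blk x y = blk (Z *v x + A *v y) (conj_transpose A *v x - Z *v y)"
  by (simp add: blk_eq_iff matrix_vector_mult_def Phi_def sum_UNIV_Plus sum_negf)

lemma hermitian_Phi:
  fixes Z :: "complex^'n^'n"
  assumes "hermitian_matrix Z"
  shows "hermitian_matrix (Phi A Z)"
  unfolding hermitian_matrix_iff_selfadjoint
proof (intro allI)
  fix u v :: "complex^('n + 'n)"
  obtain x y x' y' where "u = blk x y" "v = blk x' y'"
    by (metis blk_cases)
  moreover have "(Z *v a) \<bullet> b = a \<bullet> (Z *v b)" for a b
    using assms hermitian_matrix_iff_selfadjoint by blast
  ultimately show "(Phi A Z *v u) \<bullet> v = u \<bullet> (Phi A Z *v v)"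
    by (simp add: Phi_blk blk_inner inner_add inner_diff inner_matrix_vector_left)
qed

text \<open>The vectors \<open>(u, w u)\<close> with \<open>w\<close> aligning the phase of \<open>u\<^sup>* A u\<close> do not see \<open>Z\<close>.\<close>

lemma numerical_radius_le_largest_eigenvalue:
  fixes A Z :: "complex^'n^'n"
  assumes Z: "hermitian_matrix Z"
  shows "numerical_radius A \<le> largest_eigenvalue (Phi A Z)"
  unfolding numerical_radius_def
proof (rule cSUP_least)
  show "{u :: complex^'n. norm u = 1} \<noteq> {}"
    using vector_choose_size[of 1] by auto
  fix u :: "complex^'n" assume "u \<in> {u. norm u = 1}"
  then have u: "u \<bullet> u = 1" by (simp add: dot_square_norm)
  obtain w where w: "cmod w = 1" "w * quad_form A u = cmod (quad_form A u)"
  proof (cases "quad_form A u = 0")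
    case False
    let ?q = "quad_form A u"
    show thesis
    proof
      show "cmod (cnj ?q / cmod ?q) = 1" using False by (simp add: norm_divide)
      show "cnj ?q / cmod ?q * ?q = cmod ?q"
        using False complex_norm_square[of ?q, symmetric]
        by (simp add: power2_eq_square mult.commute)
    qed
  qed (use that[of 1] in simp)
  let ?v = "blk u (w *s u)"
  have 1: "u \<bullet> (w *s (A *v u)) = cmod (quad_form A u)"
  proof -
    have "u \<bullet> (w *s (A *v u)) = Re (w * quad_form A u)"
      by (simp only: inner_vec_eq_Re quad_form_def sum_distrib_left vector_smult_component ac_simps)
    then show ?thesis using w by simp
  qed
  \<comment> \<open>The two \<open>Z\<close> terms cancel because \<open>w\<close> is unimodular,
    and each off-diagonal block contributes \<open>cmod (quad_form A u)\<close>.\<close>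
  have "(Phi A Z *v ?v) \<bullet> ?v = 2 * cmod (quad_form A u)"
  proof -
    have "(conj_transpose A *v u) \<bullet> (w *s u) = u \<bullet> (w *s (A *v u))"
      by (simp add: inner_matrix_vector_left vec.scale)
    then show ?thesis
      using 1 by (simp add: Phi_blk blk_inner inner_add inner_diff vec.scale w inner_smult_unimodular)
        (simp add: inner_commute)
  qed
  moreover have "?v \<bullet> ?v = 2"
    using u w by (simp add: blk_inner inner_smult_unimodular)
  ultimately show "cmod (quad_form A u) \<le> largest_eigenvalue (Phi A Z)"
    using largest_eigenvalue_hermitian(2)[OF hermitian_Phi[OF Z], of A ?v] by simp
qed

section \<open>The coefficients of a disk certificate\<close>

text \<open>Extension by zero discards the irrelevant values of \<open>p\<close> and lets one
  recurrence hold at every index, both ends included.\<close>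

definition polyvec_coeff :: "(nat \<Rightarrow> complex^'n) \<Rightarrow> nat \<Rightarrow> complex^'n" where
  "polyvec_coeff p j = (if j \<in> {1..CARD('n)} then p j else 0)"

text \<open>The free bound \<open>m\<close> lets this sum and its two shifts below be compared over
  one common range.\<close>

lemma polyvec_eq_sum:
  fixes p :: "nat \<Rightarrow> complex^'n"
  assumes "CARD('n) \<le> Suc m"
  shows "polyvec p w = (\<Sum>k\<le>m. w ^ k *s polyvec_coeff p (Suc k))"
proof -
  have "polyvec p w = (\<Sum>k<CARD('n). w ^ k *s polyvec_coeff p (Suc k))"
    by (simp add: polyvec_def polyvec_coeff_def sum.atLeast1_atMost_eq)
  also have "\<dots> = (\<Sum>k\<le>m. w ^ k *s polyvec_coeff p (Suc k))"
    by (rule sum.mono_neutral_left) (use assms in \<open>auto simp: polyvec_coeff_def\<close>)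
  finally show ?thesis .
qed

lemma polyvec_shift1:
  fixes p :: "nat \<Rightarrow> complex^'n"
  assumes "CARD('n) \<le> m"
  shows "w *s polyvec p w = (\<Sum>k\<le>m. w ^ k *s polyvec_coeff p k)"
proof -
  obtain m' where m': "m = Suc m'"
    using assms by (metis not_less_eq_eq not0_implies_Suc zero_le zero_less_card_finite leD)
  have "w *s polyvec p w = (\<Sum>k\<le>m'. w ^ Suc k *s polyvec_coeff p (Suc k))"
    using assms m' by (simp add: polyvec_eq_sum[of m'] vec.scale_sum_right)
  then show ?thesis
    unfolding m' sum.atMost_Suc_shift by (simp add: polyvec_coeff_def)
qed

text \<open>Truncated subtraction is harmless: the terms at \<open>k = 0\<close> and
  \<open>k = 1\<close> both involve \<open>polyvec_coeff p 0 = 0\<close>.\<close>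

lemma polyvec_shift2:
  fixes p :: "nat \<Rightarrow> complex^'n"
  assumes "CARD('n) < m"
  shows "w\<^sup>2 *s polyvec p w = (\<Sum>k\<le>m. w ^ k *s polyvec_coeff p (k - 1))"
proof -
  obtain m' where m': "m = Suc m'"
    using assms by (cases m) auto
  have "w\<^sup>2 *s polyvec p w = w *s (w *s polyvec p w)"
    by (simp add: power2_eq_square)
  also have "\<dots> = (\<Sum>k\<le>m'. w ^ Suc k *s polyvec_coeff p k)"
    using assms m' by (simp add: polyvec_shift1[of m'] vec.scale_sum_right)
  finally show ?thesis
    unfolding m' sum.atMost_Suc_shift by (simp add: polyvec_coeff_def)
qed

text \<open>A nonzero coefficient gives a component polynomial with finitely many roots, but the
  circle is infinite.\<close>

lemma vector_poly_eq_0_on_circle: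
  fixes c :: "nat \<Rightarrow> complex^'n"
  assumes "\<And>w. cmod w = 1 \<Longrightarrow> (\<Sum>k\<le>m. w ^ k *s c k) = 0" and "k \<le> m"
  shows "c k = 0"
proof (rule ccontr)
  assume "c k \<noteq> 0"
  then obtain i where i: "c k $ i \<noteq> 0"
    by (metis vec_eq_iff zero_index)
  then have fin: "finite {w. (\<Sum>k\<le>m. c k $ i * w ^ k) = 0}"
    unfolding polyfun_finite_roots using assms(2) by blast
  have "sphere (0::complex) 1 \<subseteq> {w. (\<Sum>k\<le>m. c k $ i * w ^ k) = 0}"
  proof
    fix w :: complex assume "w \<in> sphere 0 1"
    then have "(\<Sum>k\<le>m. w ^ k *s c k) $ i = 0"
      using assms(1) by simp
    then show "w \<in> {w. (\<Sum>k\<le>m. c k $ i * w ^ k) = 0}"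
      by (simp add: mult.commute)
  qed
  then have "finite (sphere (0::complex) 1)"
    using fin finite_subset by blast
  \<comment> \<open>Infinitude of the circle: a finite connected set has at most one point, while
    \<open>1\<close> and \<open>-1\<close> both lie on it.\<close>
  moreover have "connected (sphere (0::complex) 1)"
    by (rule connected_sphere) simp
  ultimately obtain a where "sphere (0::complex) 1 \<subseteq> {a}"
    using connected_finite_iff_sing[of "sphere (0::complex) 1"] by (metis empty_subsetI order_refl)
  moreover have "1 \<in> sphere (0::complex) 1" "-1 \<in> sphere (0::complex) 1"
    by auto
  ultimately have "(1::complex) = -1" by blast
  then show False by simp
qed

lemma hermitian_pencil_mult:
  "hermitian_pencil A w *v x = cnj w *s (A *v x) + w *s (conj_transpose A *v x)"
  by (simp add: hermitian_pencil_def map_matrix_def matrix_vector_mult_def vec_eq_iff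
      sum_distrib_left sum.distrib algebra_simps)

text \<open>On the circle, multiplying the certificate equation by \<open>w\<close> removes
  \<open>cnj w\<close> and leaves \<open>A p + w^2 A^* p = 2 r w p\<close>, a polynomial identity
  whose coefficients can be compared.\<close>

lemma disk_certificate_recurrence:
  fixes A :: "complex^'n^'n"
  assumes "disk_certificate A p"
  shows "A *v polyvec_coeff p (Suc k) + conj_transpose A *v polyvec_coeff p (k - 1)
    = (2 * numerical_radius A) *\<^sub>R polyvec_coeff p k"
proof -
  let ?q = "polyvec_coeff p" and ?r = "complex_of_real (2 * numerical_radius A)"
  define c where "c k = A *v ?q (Suc k) + conj_transpose A *v ?q (k - 1) - ?r *s ?q k" for k
  obtain m where m: "CARD('n) < m"
    by blast
  have "(\<Sum>k\<le>m. w ^ k *s c k) = 0" if w: "cmod w = 1" for w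
  proof -
    have cw: "w * cnj w = 1"
      using complex_norm_square[of w] w by simp
    have "w *s (hermitian_pencil A w *v polyvec p w) = w *s (?r *s polyvec p w)"
      using assms w by (simp add: disk_certificate_def)
    then have "A *v polyvec p w + conj_transpose A *v (w\<^sup>2 *s polyvec p w)
        - ?r *s (w *s polyvec p w) = 0"
      by (simp add: hermitian_pencil_mult vec.scale_right_distrib vec.scale cw power2_eq_square
          mult.commute)
    moreover have "A *v polyvec p w = (\<Sum>k\<le>m. w ^ k *s (A *v ?q (Suc k)))"
      using m by (simp add: polyvec_eq_sum[of m] vec.linear_sum[OF matrix_vector_mul_linear_gen]
          vec.scale)
    moreover have "conj_transpose A *v (w\<^sup>2 *s polyvec p w)
        = (\<Sum>k\<le>m. w ^ k *s (conj_transpose A *v ?q (k - 1)))"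
      using m by (simp add: polyvec_shift2[of m] vec.linear_sum[OF matrix_vector_mul_linear_gen] vec.scale)
    moreover have "?r *s (w *s polyvec p w) = (\<Sum>k\<le>m. w ^ k *s (?r *s ?q k))"
      using m by (simp add: polyvec_shift1[of m] vec.scale_sum_right mult.commute)
    ultimately show ?thesis
      by (simp add: c_def vec.scale_right_distrib vec.scale_right_diff_distrib sum.distrib
          sum_subtractf)
  qed
  then have "c k = 0" if "k \<le> m"
    using vector_poly_eq_0_on_circle that by blast
  \<comment> \<open>Here even \<open>k - 1\<close> exceeds \<open>CARD('n)\<close>, so all three
    coefficients are zero.\<close>
  moreover have "c k = 0" if "\<not> k \<le> m"
    using that m by (auto simp: c_def polyvec_coeff_def)
  ultimately have "c k = 0" by blast
  then show ?thesis
    by (simp add: c_def of_real_smult_eq_scaleR del: of_real_mult)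
qed

text \<open>All values of \<open>p\<close> lie in the span of its \<open>n\<close> coefficients, so
  these span; \<open>n\<close> spanning vectors in dimension \<open>n\<close> are independent and
  distinct.\<close>

lemma spanning_polyvec_coeff:
  fixes p :: "nat \<Rightarrow> complex^'n"
  assumes "spanning_polyvec p"
  defines "B \<equiv> polyvec_coeff p ` {1..CARD('n)}"
  shows "vec.span B = UNIV" "vec.independent B" "inj_on (polyvec_coeff p) {1..CARD('n)}"
proof -
  have "polyvec p w \<in> vec.span B" for w
    unfolding polyvec_def B_def
    by (intro vec.span_sum vec.span_scale vec.span_base) (auto simp: polyvec_coeff_def image_iff)
  then have "vec.span (polyvec p ` {w. cmod w = 1}) \<subseteq> vec.span B"
    by (intro vec.span_minimal) auto
  then show span: "vec.span B = UNIV"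
    using assms(1) by (auto simp: spanning_polyvec_def)
  have fin: "finite B" and card: "card B \<le> CARD('n)"
    using card_image_le[of "{1..CARD('n)}" "polyvec_coeff p"] by (auto simp: B_def)
  have dim: "vec.dim (UNIV :: (complex^'n) set) = CARD('n)"
    by (rule vec_dim_card)
  show "vec.independent B"
    by (rule vec.card_le_dim_spanning[of _ UNIV]) (use span fin card dim in auto)
  then have "card B = CARD('n)"
    using vec.dim_eq_card_independent vec.dim_span span dim by metis
  then show "inj_on (polyvec_coeff p) {1..CARD('n)}"
    by (intro eq_card_imp_inj_on) (simp_all add: B_def)
qed

section \<open>The representor attached to a certificate\<close>

text \<open>Independence of the image set alone would not notice repetitions; two equal members
  would give a relation with coefficients \<open>1\<close> and \<open>-1\<close>.\<close>

lemma independent_familyI: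
  fixes k :: "'i \<Rightarrow> complex^'m"
  assumes fin: "finite I"
    and zero: "\<And>c i. (\<Sum>i\<in>I. c i *s k i) = 0 \<Longrightarrow> i \<in> I \<Longrightarrow> c i = 0"
  shows "inj_on k I" "vec.independent (k ` I)"
proof -
  show inj: "inj_on k I"
  proof (rule inj_onI, rule ccontr)
    fix i j assume ij: "i \<in> I" "j \<in> I" "k i = k j" "i \<noteq> j"
    let ?c = "\<lambda>l. if l = i then 1 else if l = j then -1 else (0::complex)"
    have "(\<Sum>l\<in>I. ?c l *s k l) = (\<Sum>l\<in>{i, j}. ?c l *s k l)"
      by (rule sum.mono_neutral_right) (use fin ij in auto)
    also have "\<dots> = 0" using ij by simp
    finally show False using zero[of ?c i] ij by simp
  qed
  show "vec.independent (k ` I)"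
    using zero[of "\<lambda>i. u (k i)" for u] fin
    by (auto simp: vec.dependent_finite sum.reindex[OF inj])
qed

text \<open>Models the zero-extended coefficients of a certificate. As \<open>0 - 1 = 0\<close> on
  naturals and \<open>q 0 = 0\<close>, the recurrence at \<open>k = 0\<close> reads
  \<open>A *v q 1 = 0\<close>.\<close>

locale certificate_basis =
  fixes A :: "complex^'n^'n" and r :: real and q :: "nat \<Rightarrow> complex^'n"
  assumes q_0: "q 0 = 0"
    and q_beyond: "\<And>j. CARD('n) < j \<Longrightarrow> q j = 0"
    and recurrence: "\<And>k. A *v q (Suc k) + conj_transpose A *v q (k - 1) = (2 * r) *\<^sub>R q k"
    and span_q: "vec.span (q ` {1..CARD('n)}) = UNIV"
    and independent_q: "vec.independent (q ` {1..CARD('n)})"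
    and inj_q: "inj_on q {1..CARD('n)}"
begin

lemma q_coeffs_zero:
  assumes "(\<Sum>j=1..CARD('n). c j *s q j) = 0" and "j \<in> {1..CARD('n)}"
  shows "c j = 0"
proof -
  let ?u = "\<lambda>v. c (inv_into {1..CARD('n)} q v)"
  have ind: "u v = 0" if "(\<Sum>v\<in>q ` {1..CARD('n)}. u v *s v) = 0" "v \<in> q ` {1..CARD('n)}" for u v
    using independent_q that vec.dependent_finite[of "q ` {1..CARD('n)}"] by blast
  have "(\<Sum>v\<in>q ` {1..CARD('n)}. ?u v *s v) = (\<Sum>j=1..CARD('n). c j *s q j)"
    unfolding sum.reindex[OF inj_q] by (rule sum.cong) (auto simp only: o_def inv_into_f_f[OF inj_q])
  then have "?u (q j) = 0"
    using ind[of ?u "q j"] assms by (metis imageI)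
  then show ?thesis
    using assms(2) by (simp only: inv_into_f_f[OF inj_q])
qed

text \<open>Prescribed on the basis and extended linearly; at the remaining indices both sides
  vanish.\<close>

lemma representor_exists: "\<exists>Z. \<forall>j. Z *v q j = r *\<^sub>R q j - A *v q (Suc j)"
proof -
  let ?f = "\<lambda>v. r *\<^sub>R v - A *v q (Suc (inv_into {1..CARD('n)} q v))"
  obtain g where lin: "Vector_Spaces.linear (*s) (*s) g"
    and g: "\<And>v. v \<in> q ` {1..CARD('n)} \<Longrightarrow> g v = ?f v"
    using vec.linear_independent_extend[OF independent_q, of ?f] by blast
  have "matrix g *v q j = r *\<^sub>R q j - A *v q (Suc j)" for j
  proof (cases "j \<in> {1..CARD('n)}")
    case True
    then show ?thesis
      using g[of "q j"] by (simp add: matrix_works[OF lin] inv_into_f_f[OF inj_q] del: One_nat_def)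
  next
    case False
    then have "q j = 0" using q_0 q_beyond[of j] by (cases "j = 0") auto
    \<comment> \<open>For \<open>j = 0\<close> this is the recurrence at \<open>0\<close>; for
      \<open>j\<close> above \<open>n\<close> the next coefficient is already zero.\<close>
    moreover have "A *v q (Suc j) = 0"
      using False recurrence[of 0] q_0 q_beyond[of "Suc j"] by (cases "j = 0") auto
    ultimately show ?thesis by simp
  qed
  then show ?thesis by blast
qed

text \<open>By the recurrence, the difference of the two sides depends only on \<open>i - j\<close>, and it
  vanishes once \<open>i\<close> exceeds \<open>n\<close>.\<close>

lemma A_shift_symmetric:
  "(A *v (a *s q (Suc i))) \<bullet> (b *s q j) = (a *s q i) \<bullet> (A *v (b *s q (Suc j)))"
proof (cases "i \<le> Suc CARD('n)")
  case True
  have rec: "conj_transpose A *v (c *s q k)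
      = (2 * r) *\<^sub>R (c *s q (Suc k)) - A *v (c *s q (Suc (Suc k)))" for c k
  proof -
    have "conj_transpose A *v q k = (2 * r) *\<^sub>R q (Suc k) - A *v q (Suc (Suc k))"
      using recurrence[of "Suc k"] by (simp add: algebra_simps)
    then show ?thesis
      by (simp add: vec.scale vec.scale_right_diff_distrib mult.commute
          flip: of_real_smult_eq_scaleR)
  qed
  \<comment> \<open>Descends from \<open>i = n + 1\<close>, where both sides vanish;
    \<open>j\<close> is arbitrary since the induction hypothesis is used at
    \<open>Suc j\<close>.\<close>
  show ?thesis
    using True
  proof (induction i arbitrary: j rule: inc_induct)
    case base
    then show ?case by (simp add: q_beyond)
  next
    case (step i)
    have "(A *v (a *s q (Suc i))) \<bullet> (b *s q j)
        = (2 * r) * ((a *s q (Suc i)) \<bullet> (b *s q (Suc j)))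
          - (a *s q (Suc i)) \<bullet> (A *v (b *s q (Suc (Suc j))))"
      by (simp add: inner_matrix_vector_left rec inner_diff)
    also have "\<dots> = (2 * r) * ((a *s q (Suc i)) \<bullet> (b *s q (Suc j)))
          - (A *v (a *s q (Suc (Suc i)))) \<bullet> (b *s q (Suc j))"
      by (simp only: step.IH)
    also have "\<dots> = (conj_transpose A *v (a *s q i)) \<bullet> (b *s q (Suc j))"
      by (simp add: rec inner_diff)
    finally show ?case
      by (simp add: inner_matrix_vector_left)
  qed
qed (simp add: q_beyond)

context
  fixes Z
  assumes Z: "\<And>j. Z *v q j = r *\<^sub>R q j - A *v q (Suc j)"
begin

text \<open>\<open>A_shift_symmetric\<close> settles the basis vectors. Its complex scalars
  \<open>a\<close>, \<open>b\<close> matter because the inner product is only real-bilinear, while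
  \<open>u\<close> and \<open>v\<close> are complex combinations.\<close>

lemma representor_hermitian: "hermitian_matrix Z"
  unfolding hermitian_matrix_iff_selfadjoint
proof (intro allI)
  fix u v :: "complex^'n"
  have expand: "\<exists>c. x = (\<Sum>j=1..CARD('n). c j *s q j)" for x
  proof -
    have "x \<in> vec.span (q ` {1..CARD('n)})" using span_q by simp
    then obtain c where "x = (\<Sum>v\<in>q ` {1..CARD('n)}. c v *s v)"
      by (auto simp: vec.span_finite)
    then have "x = (\<Sum>j=1..CARD('n). c (q j) *s q j)"
      by (simp add: sum.reindex[OF inj_q] del: One_nat_def)
    then show ?thesis by (rule exI[of _ "\<lambda>j. c (q j)"])
  qed
  obtain a b where u: "u = (\<Sum>i=1..CARD('n). a i *s q i)"
    and v: "v = (\<Sum>j=1..CARD('n). b j *s q j)"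
    using expand by metis
  have Zs: "Z *v (c *s q j) = r *\<^sub>R (c *s q j) - A *v (c *s q (Suc j))" for c j
    by (simp add: Z vec.scale vec.scale_right_diff_distrib mult.commute
        flip: of_real_smult_eq_scaleR)
  have "(Z *v (a i *s q i)) \<bullet> (b j *s q j) = (a i *s q i) \<bullet> (Z *v (b j *s q j))" for i j
    by (simp only: Zs inner_diff A_shift_symmetric) simp
  then show "(Z *v u) \<bullet> v = u \<bullet> (Z *v v)"
    by (simp add: u v vec.linear_sum[OF matrix_vector_mul_linear_gen] inner_sum_left
        inner_sum_right)
qed

section \<open>The eigenvalue \<open>r\<close> of \<open>Phi A Z\<close>: multiplicity and
  maximality\<close>

lemma Phi_eigenvector:
  "Phi A Z *v blk (q j) (q (Suc j)) = r *\<^sub>R blk (q j) (q (Suc j))"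
proof -
  have "conj_transpose A *v q j - Z *v q (Suc j) = r *\<^sub>R q (Suc j)"
    using recurrence[of "Suc j"] by (simp add: Z algebra_simps mult_2 flip: scaleR_add_left)
  then show ?thesis
    by (simp add: Phi_blk Z blk_smult flip: of_real_smult_eq_scaleR)
qed

text \<open>The indices \<open>0\<close> to \<open>n\<close> give \<open>n + 1\<close> eigenvectors.
  In a vanishing combination the upper blocks kill the coefficients from \<open>1\<close> on, since
  \<open>q 0 = 0\<close>; the lower blocks then leave \<open>c 0 *s q 1 = 0\<close>.\<close>

lemma eigenvalue_mult_Phi: "CARD('n) < eigenvalue_mult (Phi A Z) (complex_of_real r)"
proof -
  let ?k = "\<lambda>j. blk (q j) (q (Suc j))" and ?n = "CARD('n)"
  have zero: "c i = 0" if sum: "(\<Sum>j\<in>{0..?n}. c j *s ?k j) = 0" and i: "i \<in> {0..?n}" for c i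
  proof -
    have top: "(\<Sum>j\<in>{0..?n}. c j *s q j) = 0" and bot: "(\<Sum>j\<in>{0..?n}. c j *s q (Suc j)) = 0"
      using sum by (simp_all add: blk_smult blk_sum flip: blk_zero)
    have c: "c j = 0" if "j \<in> {1..?n}" for j
      using top q_0 q_coeffs_zero[of c j] that by (simp add: sum.atLeast_Suc_atMost)
    then have "c 0 *s q 1 = 0"
      using bot by (simp add: sum.atLeast_Suc_atMost)
    moreover have "q 1 \<noteq> 0"
      using independent_q vec.dependent_zero[of "q ` {1..?n}"] by force
    ultimately have "c 0 = 0" by simp
    then show ?thesis using c i by (cases "i = 0") auto
  qed
  have ind: "inj_on ?k {0..?n}" "vec.independent (?k ` {0..?n})"
    using independent_familyI[of "{0..?n}" ?k] zero by blast+
  have "?n < card (?k ` {0..?n})"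
    using ind(1) by (simp add: card_image)
  also have "\<dots> \<le> eigenvalue_mult (Phi A Z) (complex_of_real r)"
    unfolding eigenvalue_mult_def
    by (rule vec.independent_card_le_dim[OF _ ind(2)])
      (auto simp: of_real_smult_eq_scaleR Phi_eigenvector)
  finally show ?thesis .
qed

text \<open>Since \<open>(0, q\<^sub>j\<^sub>+\<^sub>1) = (q\<^sub>j, q\<^sub>j\<^sub>+\<^sub>1) - (q\<^sub>j, q\<^sub>j) + (0, q\<^sub>j)\<close>, the diagonal and the
  eigenspace together span everything.\<close>

lemma blk_decomposition:
  "\<exists>u k. blk x y = blk u u + k \<and> Phi A Z *v k = r *\<^sub>R k"
proof -
  \<comment> \<open>Subtracting \<open>blk x x\<close> reduces the claim to vectors
    \<open>blk 0 y\<close>; the good \<open>y\<close> form a complex subspace, so the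
    \<open>q j\<close> suffice.\<close>
  define S where "S = {y. \<exists>u k. blk 0 y = blk u u + k \<and> Phi A Z *v k = r *\<^sub>R k}"
  have lin: "linear ((*v) (Phi A Z))" by (rule linear_matrix_vector_complex)
  have "vec.subspace S"
  proof (rule vec.subspaceI)
    show "0 \<in> S"
      unfolding S_def by (auto intro!: exI[of _ 0] simp: blk_zero)
  next
    fix y y' assume "y \<in> S" "y' \<in> S"
    then obtain u k u' k' where "blk 0 y = blk u u + k" "Phi A Z *v k = r *\<^sub>R k"
      "blk 0 y' = blk u' u' + k'" "Phi A Z *v k' = r *\<^sub>R k'"
      unfolding S_def by blast
    then have "blk 0 (y + y') = blk (u + u') (u + u') + (k + k')"
      "Phi A Z *v (k + k') = r *\<^sub>R (k + k')"
      using blk_add[of 0 y 0 y'] blk_add[of u u u' u']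
      by (simp_all add: linear_add[OF lin] algebra_simps)
    then show "y + y' \<in> S" unfolding S_def by blast
  next
    fix c y assume "y \<in> S"
    then obtain u k where "blk 0 y = blk u u + k" "Phi A Z *v k = r *\<^sub>R k"
      unfolding S_def by blast
    then have "blk 0 (c *s y) = blk (c *s u) (c *s u) + c *s k"
      "Phi A Z *v (c *s k) = r *\<^sub>R (c *s k)"
      using blk_smult[of c 0 y] blk_smult[of c u u]
      by (simp_all add: vec.scale vec.scale_right_distrib mult.commute
          flip: of_real_smult_eq_scaleR)
    then show "c *s y \<in> S" unfolding S_def by blast
  qed
  moreover have "q j \<in> S" for j
  proof (induction j)
    case 0
    show ?case using \<open>vec.subspace S\<close> vec.subspace_0 q_0 by metis
  next
    case (Suc j)
    then obtain u k where uk: "blk 0 (q j) = blk u u + k" "Phi A Z *v k = r *\<^sub>R k"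
      unfolding S_def by blast
    have "blk 0 (q (Suc j)) = blk (u - q j) (u - q j) + (k + blk (q j) (q (Suc j)))"
    proof -
      have 1: "blk 0 (q (Suc j)) + blk (q j) (q j) = blk 0 (q j) + blk (q j) (q (Suc j))"
        by (simp add: blk_add add.commute)
      have 2: "blk (u - q j) (u - q j) + blk (q j) (q j) = blk u u"
        by (simp add: blk_add)
      have "blk 0 (q (Suc j)) + blk (q j) (q j)
          = blk (u - q j) (u - q j) + (k + blk (q j) (q (Suc j))) + blk (q j) (q j)"
        unfolding 1 uk(1) 2[symmetric] by (simp only: ac_simps)
      then show ?thesis by (rule add_right_imp_eq)
    qed
    moreover have "Phi A Z *v (k + blk (q j) (q (Suc j))) = r *\<^sub>R (k + blk (q j) (q (Suc j)))"
      by (simp add: linear_add[OF lin] uk Phi_eigenvector scaleR_add_right)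
    ultimately show ?case unfolding S_def by blast
  qed
  ultimately have "vec.span (q ` {1..CARD('n)}) \<subseteq> S"
    by (intro vec.span_minimal) auto
  then have "y - x \<in> S" using span_q by auto
  then obtain u k where uk: "blk 0 (y - x) = blk u u + k" "Phi A Z *v k = r *\<^sub>R k"
    unfolding S_def by blast
  have "blk x y = blk x x + blk 0 (y - x)"
    by (simp add: blk_add)
  also have "\<dots> = blk (x + u) (x + u) + k"
    by (simp add: uk blk_add flip: add.assoc)
  finally show ?thesis using uk(2) by blast
qed

text \<open>Since \<open>r - Phi A Z\<close> is self-adjoint and kills \<open>k\<close>, its form at
  \<open>blk u u + k\<close> equals that at \<open>blk u u\<close>, where \<open>Z\<close> cancels
  and twice \<open>r |u|^2 - u \<bullet> A u\<close> remains.\<close>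

lemma Phi_le:
  assumes A: "\<And>u. u \<bullet> (A *v u) \<le> r * (u \<bullet> u)"
  shows "(Phi A Z *v v) \<bullet> v \<le> r * (v \<bullet> v)"
proof -
  have lin: "linear ((*v) (Phi A Z))" by (rule linear_matrix_vector_complex)
  obtain u k where v: "v = blk u u + k" and k: "Phi A Z *v k = r *\<^sub>R k"
    by (metis blk_cases blk_decomposition)
  have "(Phi A Z *v blk u u) \<bullet> k = r * (blk u u \<bullet> k)"
    using hermitian_Phi[OF representor_hermitian, of A] k
    by (simp add: hermitian_matrix_iff_selfadjoint)
  moreover have "(Phi A Z *v blk u u) \<bullet> blk u u = 2 * (u \<bullet> (A *v u))"
    using inner_matrix_vector_left[of "conj_transpose A" u u]
    by (simp add: Phi_blk blk_inner inner_add inner_diff inner_commute[of _ u])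
  moreover have "blk u u \<bullet> blk u u = 2 * (u \<bullet> u)"
    by (simp add: blk_inner)
  ultimately show ?thesis
    using A[of u]
    by (simp add: v k linear_add[OF lin] inner_add inner_commute[of k "blk u u"] distrib_left)
qed

end

end

theorem theorem6p8:
  fixes A :: "complex^'n^'n"
  assumes "CARD('n) > 1"
    and "A \<noteq> 0"
    and "has_spanning_disk_certificate A \<or> strongly_certified A"
  shows "multiplicity_property A"
proof -
  let ?r = "numerical_radius A"
  obtain p where p: "disk_certificate A p" "spanning_polyvec p"
    using assms(3) by (auto simp: strongly_certified_def has_spanning_disk_certificate_def)
  interpret certificate_basis A ?r "polyvec_coeff p"
    by (unfold_locales; (rule disk_certificate_recurrence[OF p(1)] spanning_polyvec_coeff[OF p(2)])?)
      (simp_all add: polyvec_coeff_def)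
  obtain Z where Z: "\<And>j. Z *v polyvec_coeff p j = ?r *\<^sub>R polyvec_coeff p j - A *v polyvec_coeff p (Suc j)"
    using representor_exists by blast
  have herm: "hermitian_matrix Z" by (rule representor_hermitian[OF Z])
  obtain v where v: "v \<noteq> 0" "Phi A Z *v v = largest_eigenvalue (Phi A Z) *\<^sub>R v"
    using largest_eigenvalue_hermitian(1)[OF hermitian_Phi[OF herm]] by blast
  \<comment> \<open>Evaluating the upper bound on the form at a top eigenvector turns it into a
    bound on the eigenvalue.\<close>
  have "largest_eigenvalue (Phi A Z) * (v \<bullet> v) \<le> ?r * (v \<bullet> v)"
    using Phi_le[OF Z inner_le_numerical_radius, of v] v by simp
  then have "largest_eigenvalue (Phi A Z) \<le> ?r"
    using v(1) by simp
  then have eq: "largest_eigenvalue (Phi A Z) = ?r"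
    using numerical_radius_le_largest_eigenvalue[OF herm, of A] by simp
  \<comment> \<open>The lower bound \<open>?r\<close> holds for every Hermitian matrix and is
    attained at \<open>Z\<close>, so \<open>Z\<close> is a minimizer.\<close>
  have "sdp_representor A Z"
    unfolding sdp_representor_def eq using herm numerical_radius_le_largest_eigenvalue by blast
  moreover have "CARD('n) < eigenvalue_mult (Phi A Z) (complex_of_real ?r)"
    by (rule eigenvalue_mult_Phi[OF Z])
  ultimately show ?thesis
    unfolding multiplicity_property_def using eq by auto
qed

end
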